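(* Let $\epsilon\in[0,1]$ and let $\Lambda(\epsilon)=\epsilon(1+|\log\epsilon|)$ if $\epsilon>0$, $\Lambda(0)=0$. For every $\Lambda'<\Lambda(\epsilon)$ there exist a probability space $(\Omega,\mathcal B,\Pr)$ and sub-$\sigma$-algebras $\mathcal F,\mathcal G$ of $\mathcal B$ satisfying $$\forall A\in\mathcal F,\ \forall B\in\mathcal G\qquad \Pr[A\cap B]-\Pr[A]\Pr[B]\ \le\ \epsilon\sqrt{\Pr[A]\Pr[A^{c}]\Pr[B]\Pr[B^{c}]},$$ and such that $\{\mathcal F:\mathcal G\}\ge\Lambda'$.
   Context: $A^c$ is the complement of $A$; $\log$ is the natural logarithm. The Hilbertian (maximal) correlation coefficient of $\mathcal F$ and $\mathcal G$ is $$\{\mathcal F:\mathcal G\}=\sup_{f,g}\frac{|\operatorname{Cov}(f,g)|}{\operatorname{sd}(f)\operatorname{sd}(g)},$$ the supremum being over real square-integrable, not a.s. constant $f$ ($\mathcal F$-measurable) and $g$ ($\mathcal G$-measurable), where $\operatorname{sd}$ denotes the standard deviation; it is $0$ if $\mathcal F$ or $\mathcal G$ is trivial. *)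

theory Defs
  imports "HOL-Probability.Probability"
begin

definition Lambda :: "real \<Rightarrow> real" where
  "Lambda \<epsilon> = (if \<epsilon> > 0 then \<epsilon> * (1 + \<bar>ln \<epsilon>\<bar>) else 0)"

definition covar :: "'a measure \<Rightarrow> ('a \<Rightarrow> real) \<Rightarrow> ('a \<Rightarrow> real) \<Rightarrow> real" where
  "covar M f g = (\<integral>x. (f x - (\<integral>y. f y \<partial>M)) * (g x - (\<integral>y. g y \<partial>M)) \<partial>M)"

definition std_dev :: "'a measure \<Rightarrow> ('a \<Rightarrow> real) \<Rightarrow> real" where
  "std_dev M f = sqrt (prob_space.variance M f)"

text \<open>A sub-sigma-algebra of \<open>M\<close> is represented, as in the library, by a measure \<open>F\<close> with
  \<^term>\<open>subalgebra M F\<close>. Only the space and the measurable sets of \<open>F\<close> matter: all integrals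
  and probabilities are taken with respect to \<open>M\<close>.\<close>

definition sq_int_nonconst :: "'a measure \<Rightarrow> 'a measure \<Rightarrow> ('a \<Rightarrow> real) set" where
  "sq_int_nonconst M F =
     {f \<in> borel_measurable F. integrable M (\<lambda>x. (f x)\<^sup>2) \<and> \<not> (\<exists>c. AE x in M. f x = c)}"

definition trivial_alg :: "'a measure \<Rightarrow> 'a measure \<Rightarrow> bool" where
  "trivial_alg M F \<longleftrightarrow> (\<forall>A\<in>sets F. measure M A = 0 \<or> measure M A = 1)"

definition correlation_ratios :: "'a measure \<Rightarrow> 'a measure \<Rightarrow> 'a measure \<Rightarrow> real set" where
  "correlation_ratios M F G =
     {\<bar>covar M f g\<bar> / (std_dev M f * std_dev M g) |f g.
        f \<in> sq_int_nonconst M F \<and> g \<in> sq_int_nonconst M G}"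

definition max_corr :: "'a measure \<Rightarrow> 'a measure \<Rightarrow> 'a measure \<Rightarrow> real" where
  "max_corr M F G =
     (if trivial_alg M F \<or> trivial_alg M G then 0 else Sup (correlation_ratios M F G))"

text \<open>The real supremum in \<^const>\<open>max_corr\<close> is over a nonempty set bounded by 1
  (Cauchy--Schwarz), hence it is a genuine least upper bound.\<close>

lemma correlation_ratios_nonempty:
  assumes "prob_space M" "subalgebra M F" "subalgebra M G"
    and "\<not> trivial_alg M F" "\<not> trivial_alg M G"
  shows "correlation_ratios M F G \<noteq> {}"
proof -
  interpret prob_space M by fact
  have *: "\<exists>f. f \<in> sq_int_nonconst M H" if sub: "subalgebra M H" and nt: "\<not> trivial_alg M H" for H
  proof -
    obtain A where A: "A \<in> sets H" "prob A \<noteq> 0" "prob A \<noteq> 1"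
      using nt by (auto simp: trivial_alg_def)
    have AM: "A \<in> sets M" using sub A by (auto simp: subalgebra_def)
    have "\<not> (AE x in M. indicator A x = (c::real))" for c
    proof
      assume ae: "AE x in M. indicator A x = c"
      show False
      proof (cases "c = 1")
        case True
        from ae have "AE x in M. x \<in> A" by eventually_elim (auto simp: True indicator_def split: if_splits)
        then show False using A AM by (simp add: prob_eq_1)
      next
        case False
        from ae have "AE x in M. x \<notin> A" using False by (auto elim!: eventually_mono simp: indicator_def)
        then show False using A AM by (simp add: prob_eq_0)
      qed
    qed
    moreover have "integrable M (\<lambda>x. (indicator A x :: real)\<^sup>2)"
      using AM by (intro integrable_const_bound[where B = 1]) (auto simp: indicator_def)
    ultimately have "(indicator A :: _ \<Rightarrow> real) \<in> sq_int_nonconst M H"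
      using A by (auto simp: sq_int_nonconst_def)
    then show ?thesis by blast
  qed
  show ?thesis using *[of F] *[of G] assms by (auto simp: correlation_ratios_def)
qed

lemma correlation_ratios_le_1:
  assumes "prob_space M" "subalgebra M F" "subalgebra M G"
    and r: "r \<in> correlation_ratios M F G"
  shows "r \<le> 1"
proof -
  interpret prob_space M by fact
  obtain f g where f: "f \<in> sq_int_nonconst M F" and g: "g \<in> sq_int_nonconst M G"
    and r: "r = \<bar>covar M f g\<bar> / (std_dev M f * std_dev M g)"
    using r by (auto simp: correlation_ratios_def)
  define c where "c f x = f x - expectation f" for f :: "'a \<Rightarrow> real" and x
  have *: "c h \<in> borel_measurable M \<and> integrable M (\<lambda>x. (c h x)\<^sup>2) \<and> std_dev M h > 0
      \<and> expectation (\<lambda>x. (c h x)\<^sup>2) = (std_dev M h)\<^sup>2"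
    if h: "h \<in> sq_int_nonconst M H" and sub: "subalgebra M H" for h H
  proof -
    have m: "h \<in> borel_measurable M" and i: "integrable M (\<lambda>x. (h x)\<^sup>2)"
      and n: "\<And>k. \<not> (AE x in M. h x = k)"
      using h measurable_from_subalg[OF sub] by (auto simp: sq_int_nonconst_def)
    have i1: "integrable M h" by (rule square_integrable_imp_integrable[OF m i])
    have i2: "integrable M (\<lambda>x. (c h x)\<^sup>2)"
      unfolding c_def power2_diff using i i1 by simp
    have "expectation (\<lambda>x. (c h x)\<^sup>2) \<noteq> 0"
    proof
      assume "expectation (\<lambda>x. (c h x)\<^sup>2) = 0"
      then have "AE x in M. (c h x)\<^sup>2 = 0"
        using integral_nonneg_eq_0_iff_AE[OF i2] by simp
      then have "AE x in M. h x = expectation h" by (simp add: c_def)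
      then show False using n by blast
    qed
    moreover have "expectation (\<lambda>x. (c h x)\<^sup>2) \<ge> 0" by simp
    ultimately have "expectation (\<lambda>x. (c h x)\<^sup>2) > 0" by linarith
    then show ?thesis using m i2 unfolding std_dev_def c_def by simp
  qed
  note F = *[OF f assms(2)] and G = *[OF g assms(3)]
  define s t where "s = std_dev M f" and "t = std_dev M g"
  have st: "s > 0" "t > 0" using F G by (auto simp: s_def t_def)
  have ip: "integrable M (\<lambda>x. c f x * c g x)"
  proof (rule Bochner_Integration.integrable_bound)
    show "integrable M (\<lambda>x. (c f x)\<^sup>2 + (c g x)\<^sup>2)" using F G by simp
    show "(\<lambda>x. c f x * c g x) \<in> borel_measurable M"
      using F G by (intro borel_measurable_times) auto
    have "\<bar>a * b\<bar> \<le> \<bar>a\<^sup>2 + b\<^sup>2\<bar>" for a b :: real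
    proof -
      have "2 * \<bar>a\<bar> * \<bar>b\<bar> \<le> a\<^sup>2 + b\<^sup>2" using sum_squares_bound[of "\<bar>a\<bar>" "\<bar>b\<bar>"] by simp
      moreover have "0 \<le> \<bar>a\<bar> * \<bar>b\<bar>" by simp
      ultimately show ?thesis unfolding abs_mult by linarith
    qed
    then show "AE x in M. norm (c f x * c g x) \<le> norm ((c f x)\<^sup>2 + (c g x)\<^sup>2)" by simp
  qed
  have k: "2 - 2 * u * covar M f g / (s * t) \<ge> 0" if u: "u\<^sup>2 = 1" for u
  proof -
    have "0 \<le> expectation (\<lambda>x. (c f x / s - u * (c g x / t))\<^sup>2)" by simp
    also have "(\<lambda>x. (c f x / s - u * (c g x / t))\<^sup>2)
        = (\<lambda>x. (c f x)\<^sup>2 / s\<^sup>2 + (c g x)\<^sup>2 / t\<^sup>2 - (2 * u / (s * t)) * (c f x * c g x))"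
      using u by (auto simp: power2_diff power_divide power_mult_distrib)
    also have "expectation \<dots> = expectation (\<lambda>x. (c f x)\<^sup>2) / s\<^sup>2 + expectation (\<lambda>x. (c g x)\<^sup>2) / t\<^sup>2
        - (2 * u / (s * t)) * expectation (\<lambda>x. c f x * c g x)"
      using F G ip by simp
    also have "\<dots> = 2 - 2 * u * covar M f g / (s * t)"
      using F G st unfolding covar_def c_def[symmetric] s_def[symmetric] t_def[symmetric] by simp
    finally show ?thesis .
  qed
  have "covar M f g / (s * t) \<le> 1" "- covar M f g / (s * t) \<le> 1"
    using k[of 1] k[of "-1"] by auto
  then have "\<bar>covar M f g / (s * t)\<bar> \<le> 1" by auto
  then show ?thesis using st unfolding r s_def[symmetric] t_def[symmetric] by (simp add: abs_mult)
qed

end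

theory Submission
  imports Defs "HOL-Real_Asymp.Real_Asymp"
begin

text \<open>
  For \<open>0 < \<epsilon> < 1\<close> the model is a truncation of the infinite measure on \<open>(0, \<infinity>)\<^sup>2\<close> with Lebesgue
  marginals and distribution function \<open>min a b (\<epsilon> sqrt (a b))\<close>. It is a mixture of measures
  carried by rays \<open>y = \<lambda> x\<close>, and bounding each ray measure of \<open>A \<times> B\<close> by the smaller of its two
  marginals already gives \<open>\<epsilon> sqrt (|A| |B|)\<close> for arbitrary sets. Its kernel is homogeneous of degree
  \<open>-1\<close>, so \<open>x powr (-1/2)\<close> is a generalised eigenfunction; the two extreme rays contribute
  \<open>\<epsilon>\<close> and the density between them \<open>\<epsilon> |ln \<epsilon>|\<close> to the eigenvalue.

  Here this is discretised geometrically: atom \<open>i\<close> has mass proportional to \<open>p powi (2 * i)\<close> with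
  \<open>p ^ K = \<epsilon>\<close>, and a ray becomes a diagonal \<open>j - i = k\<close>. Finitely many atoms
  are kept, scaled to a small total mass, and the rest of the probability sits at one extra atom.
\<close>

section \<open>From a finite symmetric joint law to a probability space\<close>

text \<open>The joint mass of a rectangle. With the whole index set as \<open>T\<close> it is the
  marginal of \<open>S\<close>, for symmetric \<open>W\<close> in either coordinate.\<close>

definition block_sum :: "('a \<Rightarrow> 'a \<Rightarrow> real) \<Rightarrow> 'a set \<Rightarrow> 'a set \<Rightarrow> real" where
  "block_sum W S T = (\<Sum>i\<in>S. \<Sum>j\<in>T. W i j)"

lemma block_sum_commute:
  assumes "\<And>i j. W i j = W j i"
  shows "block_sum W S T = block_sum W T S"
proof -
  have "block_sum W S T = (\<Sum>j\<in>T. \<Sum>i\<in>S. W i j)"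
    unfolding block_sum_def by (rule sum.swap)
  also have "\<dots> = block_sum W T S"
    unfolding block_sum_def by (intro sum.cong refl assms)
  finally show ?thesis .
qed

text \<open>The sigma-algebras are generated by the two coordinates of a random point with law
  \<open>W\<close>. By symmetry, \<open>\<phi>\<close> of either coordinate has mean
  \<open>e\<close> and variance \<open>v\<close>, and \<open>corr\<close> says that the correlation
  of these two variables is at least \<open>L\<close>.\<close>

lemma exists_space_of_finite_joint_law:
  fixes W :: "int \<Rightarrow> int \<Rightarrow> real" and \<phi> :: "int \<Rightarrow> real"
  assumes fin: "finite U"
    and nonneg: "\<And>i j. i \<in> U \<Longrightarrow> j \<in> U \<Longrightarrow> 0 \<le> W i j"
    and sym: "\<And>i j. W i j = W j i"
    and total: "block_sum W U U = 1"
    and mixing: "\<And>S T. S \<subseteq> U \<Longrightarrow> T \<subseteq> U \<Longrightarrow>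
      block_sum W S T - block_sum W S U * block_sum W T U
        \<le> \<epsilon> * sqrt (block_sum W S U * block_sum W (U - S) U
             * block_sum W T U * block_sum W (U - T) U)"
    and nontriv: "a \<in> U" "0 < block_sum W {a} U" "block_sum W {a} U < 1"
    and e: "e = (\<Sum>i\<in>U. \<Sum>j\<in>U. W i j * \<phi> i)"
    and v: "v = (\<Sum>i\<in>U. \<Sum>j\<in>U. W i j * (\<phi> i)\<^sup>2) - e\<^sup>2" and "v > 0"
    and corr: "L * v \<le> (\<Sum>i\<in>U. \<Sum>j\<in>U. W i j * (\<phi> i * \<phi> j)) - e\<^sup>2"
  shows "\<exists>(M :: (real \<times> real) measure) F G.
           prob_space M \<and> subalgebra M F \<and> subalgebra M G \<and>
           (\<forall>A\<in>sets F. \<forall>B\<in>sets G.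
              measure M (A \<inter> B) - measure M A * measure M B
                \<le> \<epsilon> * sqrt (measure M A * measure M (space M - A)
                             * measure M B * measure M (space M - B))) \<and>
           max_corr M F G \<ge> L"
proof -
  \<comment> \<open>\<open>W\<close> is controlled on \<open>U \<times> U\<close> only, so the mass
    is set to 0 elsewhere.\<close>
  define Q where "Q z = (if z \<in> U \<times> U then W (fst z) (snd z) else 0)" for z
  have Q_total: "(\<Sum>z\<in>U\<times>U. Q z) = 1"
    using total by (simp add: Q_def block_sum_def sum.cartesian_product case_prod_beta cong: sum.cong)
  have Q0: "Q z \<ge> 0" for z using nonneg by (auto simp: Q_def)
  have Q1: "(\<integral>\<^sup>+ z. ennreal (Q z) \<partial>count_space UNIV) = 1"
  proof -
    have "(\<integral>\<^sup>+ z. ennreal (Q z) \<partial>count_space UNIV) = (\<Sum>z\<in>U\<times>U. ennreal (Q z))"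
      using fin by (intro nn_integral_count_space') (auto simp: Q_def)
    also have "\<dots> = ennreal (\<Sum>z\<in>U\<times>U. Q z)" using Q0 by (intro sum_ennreal)
    finally show ?thesis using Q_total by simp
  qed
  define q where "q = embed_pmf Q"
  have q: "pmf q z = Q z" for z unfolding q_def using Q0 Q1 by (rule pmf_embed_pmf)
  have qU: "set_pmf q \<subseteq> U \<times> U" by (auto simp: set_pmf_iff q Q_def split: if_splits)
  \<comment> \<open>Indices are embedded in the real plane; the floor in the test functions below
    undoes this.\<close>
  define h :: "int \<times> int \<Rightarrow> real \<times> real" where "h = map_prod of_int of_int"
  define M where "M = measure_pmf (map_pmf h q)"
  define F :: "(real \<times> real) measure" where "F = vimage_algebra UNIV fst (count_space UNIV)"
  define G :: "(real \<times> real) measure" where "G = vimage_algebra UNIV snd (count_space UNIV)"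
  interpret M: prob_space M unfolding M_def by unfold_locales
  have subF: "subalgebra M F" and subG: "subalgebra M G"
    by (auto simp: subalgebra_def M_def F_def G_def)
  have setsF: "sets F = range (\<lambda>A. fst -` A)" and setsG: "sets G = range (\<lambda>A. snd -` A)"
    unfolding F_def G_def by (subst sets_vimage_algebra2; auto)+
  have comm: "block_sum W S T = block_sum W T S" for S T
    by (rule block_sum_commute) (rule sym)
  have meas: "measure M (A \<times> B) = block_sum W {i\<in>U. of_int i \<in> A} {j\<in>U. of_int j \<in> B}" for A B
  proof -
    have "measure M (A \<times> B) = measure q (h -` (A \<times> B))"
      by (simp add: M_def)
    also have "\<dots> = measure q (h -` (A \<times> B) \<inter> set_pmf q)"
      by (rule measure_Int_set_pmf[symmetric])
    also have "\<dots> = measure q (({i\<in>U. of_int i \<in> A} \<times> {j\<in>U. of_int j \<in> B}) \<inter> set_pmf q)"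
      using qU by (intro arg_cong2[where f = measure] refl) (auto simp: h_def)
    also have "\<dots> = measure q ({i\<in>U. of_int i \<in> A} \<times> {j\<in>U. of_int j \<in> B})"
      by (rule measure_Int_set_pmf)
    also have "\<dots> = (\<Sum>z\<in>{i\<in>U. of_int i \<in> A} \<times> {j\<in>U. of_int j \<in> B}. Q z)"
      using fin by (simp add: measure_measure_pmf_finite q)
    also have "\<dots> = block_sum W {i\<in>U. of_int i \<in> A} {j\<in>U. of_int j \<in> B}"
      unfolding block_sum_def sum.cartesian_product by (intro sum.cong) (auto simp: Q_def)
    finally show ?thesis .
  qed
  have expect: "(\<integral>z. f z \<partial>M) = (\<Sum>i\<in>U. \<Sum>j\<in>U. W i j * f (of_int i, of_int j))"
    for f :: "real \<times> real \<Rightarrow> real"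
  proof -
    have "(\<integral>z. f z \<partial>M) = (\<Sum>z\<in>U\<times>U. pmf q z *\<^sub>R f (h z))"
      unfolding M_def integral_map_pmf using fin qU by (intro integral_measure_pmf[of "U \<times> U"]) auto
    then show ?thesis
      by (simp add: q Q_def h_def sum.cartesian_product case_prod_beta map_prod_def cong: sum.cong)
  qed
  have int: "integrable M f" for f :: "real \<times> real \<Rightarrow> real"
    unfolding M_def using fin qU
    by (intro integrable_measure_pmf_finite) (auto intro!: finite_imageI finite_subset[OF qU])
  have mixing_M: "measure M (A \<inter> B) - measure M A * measure M B
       \<le> \<epsilon> * sqrt (measure M A * measure M (space M - A) * measure M B * measure M (space M - B))"
    if "A \<in> sets F" "B \<in> sets G" for A B
  proof -
    obtain A' B' where A: "A = fst -` A'" and B: "B = snd -` B'"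
      using \<open>A \<in> sets F\<close> \<open>B \<in> sets G\<close> by (auto simp: setsF setsG)
    define S T where "S = {i\<in>U. of_int i \<in> A'}" and "T = {j\<in>U. of_int j \<in> B'}"
    have eqs: "A \<inter> B = A' \<times> B'" "A = A' \<times> UNIV" "B = UNIV \<times> B'"
        "space M - A = (- A') \<times> UNIV" "space M - B = UNIV \<times> (- B')"
      by (auto simp: A B M_def)
    have compl: "{i\<in>U. of_int i \<in> - A'} = U - S" "{i\<in>U. of_int i \<in> - B'} = U - T"
      by (auto simp: S_def T_def)
    have "measure M (A \<inter> B) = block_sum W S T"
      unfolding eqs(1) meas by (simp add: S_def T_def)
    moreover have "measure M A = block_sum W S U"
      unfolding eqs(2) meas by (simp add: S_def)
    moreover have "measure M B = block_sum W T U"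
      unfolding eqs(3) meas by (simp add: T_def comm[of U])
    moreover have "measure M (space M - A) = block_sum W (U - S) U"
      unfolding eqs(4) meas compl by simp
    moreover have "measure M (space M - B) = block_sum W (U - T) U"
      unfolding eqs(5) meas compl by (simp add: comm[of U])
    ultimately show ?thesis
      using mixing[of S T] by (simp add: S_def T_def)
  qed
  define f g where "f z = \<phi> \<lfloor>fst z\<rfloor>" and "g z = \<phi> \<lfloor>snd z\<rfloor>" for z :: "real \<times> real"
  have Ef: "(\<integral>z. f z \<partial>M) = e" by (simp add: expect f_def e)
  have swap: "(\<Sum>i\<in>U. \<Sum>j\<in>U. W i j * \<psi> j) = (\<Sum>i\<in>U. \<Sum>j\<in>U. W i j * \<psi> i)" for \<psi>
    by (subst sum.swap) (intro sum.cong refl, simp add: sym)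
  have Eg: "(\<integral>z. g z \<partial>M) = e" by (simp add: expect g_def e swap)
  have Vf: "M.variance f = v"
    using M.variance_eq[of f] int[of f] int[of "\<lambda>z. (f z)\<^sup>2"] unfolding Ef v
    by (simp add: expect[of "\<lambda>z. (f z)\<^sup>2"]) (simp add: f_def)
  have Vg: "M.variance g = v"
    using M.variance_eq[of g] int[of g] int[of "\<lambda>z. (g z)\<^sup>2"] unfolding Eg v
    by (simp add: expect[of "\<lambda>z. (g z)\<^sup>2"]) (simp add: g_def swap[of "\<lambda>i. (\<phi> i)\<^sup>2"])
  have "covar M f g = (\<integral>z. f z * g z - e * f z - e * g z + e\<^sup>2 \<partial>M)"
    unfolding covar_def Ef Eg by (intro Bochner_Integration.integral_cong) (auto simp: algebra_simps power2_eq_square)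
  also have "\<dots> = (\<integral>z. f z * g z \<partial>M) - e\<^sup>2"
    using int by (simp add: Ef Eg M.prob_space power2_eq_square)
  also have "\<dots> = (\<Sum>i\<in>U. \<Sum>j\<in>U. W i j * (\<phi> i * \<phi> j)) - e\<^sup>2"
    by (simp add: expect f_def g_def)
  finally have cov: "L * v \<le> covar M f g" using corr by simp
  have nonconst: "\<not> (AE x in M. k x = c)" if "M.variance k = v" for k c
  proof
    assume ae: "AE x in M. k x = c"
    then have "M.expectation k = M.expectation (\<lambda>_. c)"
      by (intro integral_cong_AE) (auto simp: M_def)
    then have "AE x in M. (k x - M.expectation k)\<^sup>2 = 0"
      using ae by (auto simp: M.prob_space elim!: eventually_mono)
    then have "M.variance k = 0"
      by (subst integral_cong_AE[where g = "\<lambda>_. 0"]) (auto simp: M_def)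
    then show False using that \<open>v > 0\<close> by simp
  qed
  have "f \<in> borel_measurable F" "g \<in> borel_measurable G"
    unfolding f_def g_def F_def G_def
    by (rule measurable_compose[OF measurable_vimage_algebra1]; simp)+
  then have fg: "f \<in> sq_int_nonconst M F" "g \<in> sq_int_nonconst M G"
    using nonconst Vf Vg by (auto simp: sq_int_nonconst_def int)
  have ev: "measure M ({of_int a} \<times> UNIV) = block_sum W {a} U"
    "measure M (UNIV \<times> {of_int a}) = block_sum W {a} U"
  proof -
    have "{i\<in>U. real_of_int i \<in> {of_int a}} = {a}" using nontriv(1) by auto
    then show "measure M ({of_int a} \<times> UNIV) = block_sum W {a} U"
      "measure M (UNIV \<times> {of_int a}) = block_sum W {a} U"
      unfolding meas by (simp_all add: comm[of U])
  qed
  \<comment> \<open>The atom \<open>a\<close> yields events of probability strictly between 0 and 1,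
    so \<open>max_corr\<close> is the supremum and not its default 0.\<close>
  have "{of_int a} \<times> UNIV \<in> sets F" "UNIV \<times> {of_int a} \<in> sets G"
    by (auto simp: setsF setsG intro!: rev_image_eqI[of "{of_int a}"])
  then have nt: "\<not> trivial_alg M F" "\<not> trivial_alg M G"
    using nontriv ev unfolding trivial_alg_def by (metis less_irrefl)+
  have "L \<le> \<bar>covar M f g\<bar> / (std_dev M f * std_dev M g)"
    using \<open>v > 0\<close> cov by (simp add: std_dev_def Vf Vg field_simps)
  also have "\<dots> \<le> Sup (correlation_ratios M F G)"
  proof (rule cSup_upper)
    show "\<bar>covar M f g\<bar> / (std_dev M f * std_dev M g) \<in> correlation_ratios M F G"
      using fg by (auto simp: correlation_ratios_def)
    show "bdd_above (correlation_ratios M F G)"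
      using correlation_ratios_le_1[OF M.prob_space_axioms subF subG] by (intro bdd_aboveI)
  qed
  finally have "L \<le> max_corr M F G" using nt by (simp add: max_corr_def)
  then show ?thesis
    using M.prob_space_axioms subF subG mixing_M by blast
qed

section \<open>Scalar inequalities behind the mixing bound\<close>

text \<open>Restores the complement factors. Let \<open>a \<le> b\<close>. If
  \<open>a \<le> \<epsilon>\<^sup>2 * b\<close>, then \<open>x \<le> a\<close> suffices, as
  \<open>a * (1 - b) \<le> \<epsilon>\<^sup>2 * (b * (1 - a))\<close>. Otherwise
  \<open>\<epsilon> * b \<le> sqrt (a * b)\<close>, which gives
  \<open>x - a * b \<le> \<epsilon> * sqrt (a * b) * (1 - b)\<close>.\<close>

lemma covariance_bound:
  fixes a b x \<epsilon> :: real
  assumes a: "0 \<le> a" "a \<le> 1" and b: "0 \<le> b" "b \<le> 1" and \<epsilon>: "0 \<le> \<epsilon>" "\<epsilon> \<le> 1"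
    and x: "x \<le> a" "x \<le> b" "x \<le> \<epsilon> * sqrt (a * b)"
  shows "x - a * b \<le> \<epsilon> * sqrt (a * (1 - a) * b * (1 - b))"
  using a b x
proof (induction a b rule: linorder_wlog)
  case (sym a b)
  then show ?case by (simp add: mult_ac)
next
  case (le a b)
  have \<epsilon>2: "\<epsilon>\<^sup>2 \<le> 1" using \<epsilon> by (simp add: power_le_one)
  show ?case
  proof (cases "a \<le> \<epsilon>\<^sup>2 * b")
    case True
    have "a - \<epsilon>\<^sup>2 * b \<le> a * b * (1 - \<epsilon>\<^sup>2)"
      using True mult_nonneg_nonneg[of "a * b" "1 - \<epsilon>\<^sup>2"] mult_nonneg_nonneg[of a b] le \<epsilon>2 by linarith
    then have "a * (1 - b) \<le> \<epsilon>\<^sup>2 * (b * (1 - a))" by (simp add: algebra_simps)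
    then have "(a * (1 - b)) * (a * (1 - b)) \<le> (\<epsilon>\<^sup>2 * (b * (1 - a))) * (a * (1 - b))"
      using le by (intro mult_right_mono) auto
    then have "(a * (1 - b))\<^sup>2 \<le> \<epsilon>\<^sup>2 * (a * (1 - a) * b * (1 - b))"
      by (simp add: power2_eq_square mult_ac)
    then have "a * (1 - b) \<le> \<epsilon> * sqrt (a * (1 - a) * b * (1 - b))"
      using \<epsilon> real_le_rsqrt by (fastforce simp: real_sqrt_mult)
    then show ?thesis using le by (simp add: algebra_simps)
  next
    case False
    have "(1 - b)\<^sup>2 \<le> (1 - a) * (1 - b)"
      using le unfolding power2_eq_square by (intro mult_right_mono) auto
    then have "1 - b \<le> sqrt ((1 - a) * (1 - b))" by (rule real_le_rsqrt)
    then have 1: "\<epsilon> * sqrt (a * b) * (1 - b) \<le> \<epsilon> * sqrt (a * b) * sqrt ((1 - a) * (1 - b))"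
      using \<epsilon> le by (intro mult_left_mono) auto
    have "(\<epsilon> * b)\<^sup>2 \<le> a * b"
      using False le(3,4,5,6) mult_right_mono[of "\<epsilon>\<^sup>2 * b" a b] by (simp add: power2_eq_square mult_ac)
    then have "\<epsilon> * b \<le> sqrt (a * b)" by (rule real_le_rsqrt)
    then have "\<epsilon> * b * sqrt (a * b) \<le> sqrt (a * b) * sqrt (a * b)"
      using le by (intro mult_right_mono) auto
    also have "\<dots> = a * b" using le by simp
    finally have "x - a * b \<le> \<epsilon> * sqrt (a * b) * (1 - b)"
      using le by (simp add: algebra_simps)
    also note 1
    also have "\<epsilon> * sqrt (a * b) * sqrt ((1 - a) * (1 - b)) = \<epsilon> * sqrt (a * (1 - a) * b * (1 - b))"
      by (simp add: real_sqrt_mult mult_ac)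
    finally show ?thesis .
  qed
qed

text \<open>Serves the case where exactly one of two sets contains the large atom. After squaring,
  it is enough that \<open>a * b\<close> is at most \<open>\<epsilon>\<^sup>2 / 4\<close> and that
  \<open>1 - a\<close> and \<open>1 - b\<close> are at least \<open>1 / 2\<close>.\<close>

lemma product_le_of_small:
  fixes a b \<epsilon> :: real
  assumes "0 \<le> a" "a \<le> \<epsilon> / 2" "0 \<le> b" "b \<le> \<epsilon> / 2" "\<epsilon> \<le> 1"
  shows "a * b \<le> \<epsilon> * sqrt (a * (1 - a) * b * (1 - b))"
proof -
  have "a * b \<le> (\<epsilon> / 2) * (\<epsilon> / 2)" using assms by (intro mult_mono) auto
  also have "\<dots> = \<epsilon>\<^sup>2 * ((1/2) * (1/2))" by (simp add: power2_eq_square)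
  also have "\<dots> \<le> \<epsilon>\<^sup>2 * ((1 - a) * (1 - b))"
    using assms by (intro mult_left_mono mult_mono) auto
  finally have "a * b * (a * b) \<le> \<epsilon>\<^sup>2 * ((1 - a) * (1 - b)) * (a * b)"
    using assms by (intro mult_right_mono) auto
  then have "(a * b)\<^sup>2 \<le> \<epsilon>\<^sup>2 * (a * (1 - a) * b * (1 - b))"
    by (simp add: power2_eq_square mult_ac)
  then have "a * b \<le> sqrt (\<epsilon>\<^sup>2 * (a * (1 - a) * b * (1 - b)))" by (rule real_le_rsqrt)
  then show ?thesis using assms by (simp add: real_sqrt_mult)
qed

section \<open>Weights on the diagonals and their sums\<close>

text \<open>The weights on the diagonals solve \<open>(\<Sum>k. band p K k * p ^ \<bar>k - t\<bar>) = p ^ K\<close> for \<open>\<bar>t\<bar> \<le> K\<close>: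
  a constant density in the interior, completed by boundary masses at \<open>k = \<plusminus> K\<close>.\<close>

definition band :: "real \<Rightarrow> nat \<Rightarrow> int \<Rightarrow> real" where
  "band p K k = p ^ K / (1 + p) *
     (if \<bar>k\<bar> < int K then 1 - p else if \<bar>k\<bar> = int K then 1 else 0)"

context
  fixes p :: real and K :: nat
  assumes p: "0 < p" "p < 1" and K: "K \<ge> 1"
begin

lemma band_nonneg: "0 \<le> band p K k"
  using p by (auto simp: band_def)

lemma band_uminus: "band p K (- k) = band p K k"
  by (simp add: band_def)

lemma band_eq_0: "\<bar>k\<bar> > int K \<Longrightarrow> band p K k = 0"
  by (auto simp: band_def)

text \<open>Downward induction from the boundary mass at \<open>K\<close>: the new interior term
  supplies the fraction \<open>1 - p\<close> of the new value, the old tail the fraction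
  \<open>p\<close>. The strict bound on \<open>t\<close> leaves out the boundary mass at
  \<open>- K\<close>.\<close>

lemma band_tail_sum:
  assumes "- int K < t" "t \<le> int K"
  shows "(\<Sum>k\<in>{t..int K}. band p K k * p powi k) = p ^ K / (1 + p) * p powi t"
  using assms(2,1)
proof (induction t rule: int_le_induct)
  case base
  then show ?case using K by (simp add: band_def)
next
  case (step t)
  have pt: "p powi t = p * p powi (t - 1)" using p by (simp add: power_int_diff)
  have "{t - 1..int K} = insert (t - 1) {t..int K}" using step by auto
  then have "(\<Sum>k\<in>{t - 1..int K}. band p K k * p powi k)
      = band p K (t - 1) * p powi (t - 1) + p ^ K / (1 + p) * p powi t"
    using step by simp
  also have "band p K (t - 1) = p ^ K / (1 + p) * (1 - p)"
    using step by (simp add: band_def)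
  also have "p ^ K / (1 + p) * (1 - p) * p powi (t - 1) + p ^ K / (1 + p) * p powi t
      = p ^ K / (1 + p) * p powi (t - 1)"
    unfolding pt by (simp only: algebra_simps)
  finally show ?case .
qed

text \<open>The normalisation: with it, a complete row of the kernel below has mass exactly
  \<open>p powi (2 * i)\<close>.\<close>

lemma band_total_sum: "(\<Sum>k\<in>{- int K..int K}. band p K k * p powi k) = 1"
proof -
  have "{- int K..int K} = insert (- int K) {- int K + 1..int K}" by auto
  then have "(\<Sum>k\<in>{- int K..int K}. band p K k * p powi k)
      = band p K (- int K) * p powi (- int K) + p ^ K / (1 + p) * p powi (- int K + 1)"
    using K by (simp add: band_tail_sum)
  also have "p powi (- int K + 1) = p * p powi (- int K)" using p by (subst power_int_add) auto
  also have "band p K (- int K) = p ^ K / (1 + p)" by (simp add: band_def)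
  finally show ?thesis using p by (simp add: power_int_minus field_simps)
qed

text \<open>The generalised eigenvalue belonging to \<open>p powi (- i)\<close>:
  \<open>2 * K - 1\<close> interior diagonals and two boundary ones.\<close>

lemma band_mass: "(\<Sum>k\<in>{- int K..int K}. band p K k) = p ^ K * ((2 * real K - 1) * (1 - p) + 2) / (1 + p)"
proof -
  have "{- int K..int K} = insert (- int K) (insert (int K) {- int K<..<int K})" using K by auto
  then have "(\<Sum>k\<in>{- int K..int K}. band p K k)
      = band p K (- int K) + (band p K (int K) + (\<Sum>k\<in>{- int K<..<int K}. band p K k))"
    using K by simp
  also have "(\<Sum>k\<in>{- int K<..<int K}. band p K k) = (\<Sum>k\<in>{- int K<..<int K}. p ^ K / (1 + p) * (1 - p))"
    by (intro sum.cong) (auto simp: band_def)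
  also have "\<dots> = (2 * real K - 1) * (p ^ K / (1 + p) * (1 - p))"
    using K by (simp add: of_nat_diff)
  finally have "(\<Sum>k\<in>{- int K..int K}. band p K k) = p ^ K / (1 + p) + (p ^ K / (1 + p) + (2 * real K - 1) * (p ^ K / (1 + p) * (1 - p)))"
    by (simp add: band_def)
  also have "x / d + (x / d + m * (x / d * q)) = x * (m * q + 2) / d" for x d m q :: real
    by (simp add: add_divide_distrib algebra_simps)
  finally show ?thesis .
qed

lemma band_translate_sum_le:
  assumes "finite T"
  shows "(\<Sum>j\<in>T. if t \<le> j - i then band p K (j - i) * p powi (j - i) else 0)
      \<le> (\<Sum>k\<in>{t..int K}. band p K k * p powi k)"
proof -
  have "(\<Sum>j\<in>T. if t \<le> j - i then band p K (j - i) * p powi (j - i) else 0)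
      = (\<Sum>j\<in>{j\<in>T. t \<le> j - i \<and> j - i \<le> int K}. band p K (j - i) * p powi (j - i))"
    using assms by (intro sum.mono_neutral_cong_right ballI) (auto simp: not_le intro: band_eq_0)
  also have "\<dots> = (\<Sum>k\<in>(\<lambda>j. j - i) ` {j\<in>T. t \<le> j - i \<and> j - i \<le> int K}. band p K k * p powi k)"
    by (subst sum.reindex) (auto simp: inj_on_def)
  also have "\<dots> \<le> (\<Sum>k\<in>{t..int K}. band p K k * p powi k)"
    using p by (intro sum_mono2) (auto simp: band_nonneg)
  finally show ?thesis .
qed

section \<open>The homogeneous kernel on rectangles\<close>

text \<open>\<open>p powi (i + j)\<close> is the geometric mean of the masses
  \<open>p powi (2 * i)\<close> and \<open>p powi (2 * j)\<close> of the two atoms.\<close>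

abbreviation kernel :: "int \<Rightarrow> int \<Rightarrow> real" where
  "kernel i j \<equiv> band p K (j - i) * p powi (i + j)"

abbreviation weight :: "int set \<Rightarrow> real" where
  "weight S \<equiv> (\<Sum>i\<in>S. p powi (2 * i))"

lemma kernel_commute: "kernel i j = kernel j i"
  using band_uminus[of "i - j"] by (simp add: add.commute)

lemma kernel_eq: "kernel i j = p powi (2 * i) * (band p K (j - i) * p powi (j - i))"
proof -
  have "p powi (i + j) = p powi (2 * i) * p powi (j - i)"
    using p by (simp flip: power_int_add)
  then show ?thesis by simp
qed

lemma kernel_row_sum_le:
  assumes "finite T"
  shows "(\<Sum>j\<in>T. kernel i j) \<le> p powi (2 * i)"
proof -
  have "(\<Sum>j\<in>T. kernel i j) = p powi (2 * i) *
      (\<Sum>j\<in>T. if - int K \<le> j - i then band p K (j - i) * p powi (j - i) else 0)"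
    unfolding kernel_eq sum_distrib_left by (intro sum.cong) (auto simp: band_eq_0)
  also have "\<dots> \<le> p powi (2 * i) * 1"
    using p band_translate_sum_le[OF assms, of "- int K" i]
    by (intro mult_left_mono) (auto simp: band_total_sum)
  finally show ?thesis by simp
qed

lemma block_sum_kernel_le_weight:
  assumes "finite T"
  shows "block_sum kernel S T \<le> weight S"
  unfolding block_sum_def by (intro sum_mono kernel_row_sum_le assms)

text \<open>Diagonals \<open>j - i \<ge> t\<close> are charged to \<open>S\<close>, the others to \<open>T\<close>.\<close>

lemma block_sum_kernel_le_threshold:
  assumes "finite S" "finite T" "- int K < t" "t \<le> int K"
  shows "block_sum kernel S T
    \<le> p ^ K / (1 + p) * (weight S * p powi t + weight T * p powi (1 - t))"
proof -
  let ?r = "\<lambda>t i j. p powi (2 * i) * (if t \<le> j - i then band p K (j - i) * p powi (j - i) else 0)"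
  have row: "(\<Sum>j\<in>T. ?r t i j) \<le> p powi (2 * i) * (p ^ K / (1 + p) * p powi t)"
    if "finite T" "- int K < t" "t \<le> int K" for i t T
    unfolding sum_distrib_left[symmetric]
    using p that band_translate_sum_le[of T t i] by (intro mult_left_mono) (auto simp: band_tail_sum)
  \<comment> \<open>The remaining diagonals satisfy \<open>i - j \<ge> 1 - t\<close>, and
    \<open>1 - t\<close> lies in the same range as \<open>t\<close>, so \<open>row\<close> applies
    to both pieces.\<close>
  have "kernel i j = ?r t i j + ?r (1 - t) j i" for i j
  proof (cases "t \<le> j - i")
    case True
    have "?r t i j = kernel i j" unfolding if_P[OF True] by (rule kernel_eq[symmetric])
    moreover have "?r (1 - t) j i = 0" using True by simp
    ultimately show ?thesis by linarith
  next
    case False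
    then have "1 - t \<le> i - j" by simp
    then have "?r (1 - t) j i = kernel j i" by (simp only: if_True kernel_eq[symmetric])
    moreover have "?r t i j = 0" using False by simp
    ultimately show ?thesis using kernel_commute[of i j] by linarith
  qed
  then have "block_sum kernel S T = (\<Sum>i\<in>S. \<Sum>j\<in>T. ?r t i j + ?r (1 - t) j i)"
    unfolding block_sum_def by presburger
  also have "\<dots> = (\<Sum>i\<in>S. \<Sum>j\<in>T. ?r t i j) + (\<Sum>j\<in>T. \<Sum>i\<in>S. ?r (1 - t) j i)"
    unfolding sum.distrib using sum.swap[of "\<lambda>i j. ?r (1 - t) j i" T S] by simp
  also have "\<dots> \<le> (\<Sum>i\<in>S. p powi (2 * i) * (p ^ K / (1 + p) * p powi t))
      + (\<Sum>j\<in>T. p powi (2 * j) * (p ^ K / (1 + p) * p powi (1 - t)))"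
    using assms by (intro add_mono sum_mono row) auto
  also have "\<dots> = p ^ K / (1 + p) * (weight S * p powi t + weight T * p powi (1 - t))"
    unfolding sum_distrib_right[symmetric] by (simp add: algebra_simps add_divide_distrib)
  finally show ?thesis .
qed

text \<open>Consecutive powers differ by the factor \<open>p\<close>, so some
  \<open>p powi t * \<alpha>\<close> falls between \<open>p * \<beta>\<close> and
  \<open>\<beta>\<close>. The least admissible \<open>t\<close> is taken: either
  \<open>t - 1\<close> fails, or \<open>t = 1 - K\<close> and the second hypothesis applies.\<close>

lemma exists_threshold:
  assumes "p ^ K * \<alpha> \<le> \<beta>" "p ^ K * \<beta> \<le> \<alpha>"
  obtains t where "- int K < t" "t \<le> int K" "p powi t * \<alpha> \<le> \<beta>" "p * \<beta> \<le> p powi t * \<alpha>"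
proof -
  define A where "A = {t\<in>{- int K<..int K}. p powi t * \<alpha> \<le> \<beta>}"
  have fin: "finite A"
    unfolding A_def by (rule finite_subset[of _ "{- int K<..int K}"]) auto
  have ne: "int K \<in> A" using assms K by (auto simp: A_def)
  define t where "t = Min A"
  have tA: "t \<in> A" unfolding t_def using fin ne by (intro Min_in) auto
  have "p * \<beta> \<le> p powi t * \<alpha>"
  proof (cases "t - 1 = - int K")
    case True
    then have "t = 1 - int K" by simp
    then have "p powi t * p ^ K = p" using p by (simp add: power_int_diff)
    then have "p * \<beta> = p powi t * (p ^ K * \<beta>)" by simp
    also have "\<dots> \<le> p powi t * \<alpha>" using assms(2) p by (intro mult_left_mono) auto
    finally show ?thesis .
  next
    case False
    then have "t - 1 \<notin> A" using Min_le[OF fin, of "t - 1"] by (auto simp: t_def)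
    then have "\<beta> < p powi (t - 1) * \<alpha>" using False tA by (auto simp: A_def)
    then have "p * \<beta> < p * (p powi (t - 1) * \<alpha>)" using p by simp
    then show ?thesis using p by (simp add: power_int_diff)
  qed
  with tA show ?thesis by (intro that) (auto simp: A_def)
qed

text \<open>The central estimate. If the weights are far apart, the smaller marginal is already
  below the bound. Otherwise \<open>p powi t\<close> is chosen close to
  \<open>\<beta> / \<alpha>\<close>, which balances the masses charged to \<open>S\<close> and to
  \<open>T\<close>.\<close>

lemma block_sum_kernel_le_sqrt:
  assumes S: "finite S" and T: "finite T"
  shows "block_sum kernel S T \<le> p ^ K * sqrt (weight S * weight T)"
proof -
  define \<alpha> \<beta> where "\<alpha> = sqrt (weight S)" and "\<beta> = sqrt (weight T)"
  have w: "weight S = \<alpha>\<^sup>2" "weight T = \<beta>\<^sup>2" and nonneg: "0 \<le> \<alpha>" "0 \<le> \<beta>"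
    using p by (simp_all add: \<alpha>_def \<beta>_def sum_nonneg)
  have sq: "sqrt (weight S * weight T) = \<alpha> * \<beta>"
    by (simp add: \<alpha>_def \<beta>_def real_sqrt_mult)
  consider "\<beta> < p ^ K * \<alpha>" | "\<alpha> < p ^ K * \<beta>" | "p ^ K * \<alpha> \<le> \<beta>" "p ^ K * \<beta> \<le> \<alpha>"
    by linarith
  then show ?thesis
  proof cases
    case 1
    have "block_sum kernel S T \<le> \<beta> * \<beta>"
      using block_sum_kernel_le_weight[OF S, of T] block_sum_commute[of kernel S T, OF kernel_commute]
      by (simp add: w power2_eq_square)
    also have "\<dots> \<le> (p ^ K * \<alpha>) * \<beta>" using 1 nonneg by (intro mult_right_mono) auto
    finally show ?thesis by (simp add: sq)
  next
    case 2
    have "block_sum kernel S T \<le> \<alpha> * \<alpha>"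
      using block_sum_kernel_le_weight[OF T, of S] by (simp add: w power2_eq_square)
    also have "\<dots> \<le> \<alpha> * (p ^ K * \<beta>)" using 2 nonneg by (intro mult_left_mono) auto
    also have "\<dots> = p ^ K * sqrt (weight S * weight T)" unfolding sq by simp
    finally show ?thesis .
  next
    case 3
    then obtain t where t: "- int K < t" "t \<le> int K" "p powi t * \<alpha> \<le> \<beta>" "p * \<beta> \<le> p powi t * \<alpha>"
      by (rule exists_threshold)
    define y where "y = p powi t"
    have y: "y > 0" "p powi (1 - t) = p / y" using p by (auto simp: y_def power_int_diff)
    \<comment> \<open>Both factors are nonnegative by the choice of \<open>t\<close>. Expanding
      yields the constant \<open>1 + p\<close>, which cancels the denominator in
      \<open>band\<close>: discretisation costs nothing here.\<close>
    have "0 \<le> (\<beta> - y * \<alpha>) * (y * \<alpha> - p * \<beta>) / y"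
      using t y by (intro divide_nonneg_pos mult_nonneg_nonneg) (auto simp: y_def)
    also have "\<dots> = (1 + p) * (\<alpha> * \<beta>) - (\<alpha>\<^sup>2 * y + \<beta>\<^sup>2 * (p / y))"
      using y by (simp add: field_simps power2_eq_square)
    finally have "\<alpha>\<^sup>2 * y + \<beta>\<^sup>2 * (p / y) \<le> (1 + p) * (\<alpha> * \<beta>)" by simp
    then have "p ^ K / (1 + p) * (\<alpha>\<^sup>2 * y + \<beta>\<^sup>2 * (p / y)) \<le> p ^ K / (1 + p) * ((1 + p) * (\<alpha> * \<beta>))"
      using p by (intro mult_left_mono) auto
    then show ?thesis
      using block_sum_kernel_le_threshold[OF S T t(1,2)] p
      unfolding y_def[symmetric] y(2) sq by (simp add: w)
  qed
qed

text \<open>Rows \<open>K + 1\<close> to \<open>N - K\<close> contain the whole band, so truncation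
  costs at most \<open>2 * K\<close> rows, whatever \<open>N\<close> is.\<close>

lemma band_square_sum_ge:
  assumes "int N \<ge> 2 * int K"
  shows "(real N - 2 * real K) * (\<Sum>k\<in>{- int K..int K}. band p K k)
    \<le> (\<Sum>i\<in>{1..int N}. \<Sum>j\<in>{1..int N}. band p K (j - i))"
proof -
  have row: "(\<Sum>k\<in>{- int K..int K}. band p K k) \<le> (\<Sum>j\<in>{1..int N}. band p K (j - i))"
    if "i \<in> {int K + 1..int N - int K}" for i
  proof -
    have "(\<Sum>k\<in>{- int K..int K}. band p K k) = (\<Sum>j\<in>{i - int K..i + int K}. band p K (j - i))"
      by (rule sum.reindex_bij_witness[of _ "\<lambda>j. j - i" "\<lambda>k. k + i"]) auto
    also have "\<dots> \<le> (\<Sum>j\<in>{1..int N}. band p K (j - i))"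
      using that by (intro sum_mono2) (auto simp: band_nonneg)
    finally show ?thesis .
  qed
  have "(real N - 2 * real K) * (\<Sum>k\<in>{- int K..int K}. band p K k)
      = (\<Sum>i\<in>{int K + 1..int N - int K}. \<Sum>k\<in>{- int K..int K}. band p K k)"
    using assms by (simp add: of_nat_diff)
  also have "\<dots> \<le> (\<Sum>i\<in>{int K + 1..int N - int K}. \<Sum>j\<in>{1..int N}. band p K (j - i))"
    by (intro sum_mono row)
  also have "\<dots> \<le> (\<Sum>i\<in>{1..int N}. \<Sum>j\<in>{1..int N}. band p K (j - i))"
    by (intro sum_mono2) (auto intro!: sum_nonneg band_nonneg)
  finally show ?thesis .
qed

end

section \<open>The law with one additional large atom\<close>

lemma block_sum_Un_left:
  assumes "finite S" "finite S'" "S \<inter> S' = {}"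
  shows "block_sum W (S \<union> S') T = block_sum W S T + block_sum W S' T"
  using assms by (simp add: block_sum_def sum.union_disjoint)

lemma block_sum_mono:
  assumes "finite S'" "finite T'" "S \<subseteq> S'" "T \<subseteq> T'" "\<And>i j. i \<in> S' \<Longrightarrow> j \<in> T' \<Longrightarrow> 0 \<le> W i j"
  shows "block_sum W S T \<le> block_sum W S' T'"
proof -
  have "block_sum W S T \<le> block_sum W S T'"
    unfolding block_sum_def using assms by (intro sum_mono sum_mono2) auto
  also have "\<dots> \<le> block_sum W S' T'"
    unfolding block_sum_def using assms by (intro sum_mono2 sum_nonneg) auto
  finally show ?thesis .
qed

text \<open>Adding one large atom \<open>z\<close> costs nothing: passing to complements reduces to sets that avoid
  \<open>z\<close>, or to one set avoiding and one containing \<open>z\<close>, where smallness suffices.\<close>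

lemma mixing_from_small_part:
  fixes W :: "'a \<Rightarrow> 'a \<Rightarrow> real"
  assumes U: "finite U" "z \<in> U"
    and nonneg: "\<And>i j. i \<in> U \<Longrightarrow> j \<in> U \<Longrightarrow> 0 \<le> W i j"
    and sym: "\<And>i j. W i j = W j i"
    and total: "block_sum W U U = 1"
    and \<epsilon>: "\<epsilon> \<le> 1" and small: "block_sum W (U - {z}) U \<le> \<epsilon> / 2"
    and part: "\<And>S T. S \<subseteq> U - {z} \<Longrightarrow> T \<subseteq> U - {z} \<Longrightarrow>
      block_sum W S T \<le> \<epsilon> * sqrt (block_sum W S U * block_sum W T U)"
    and S: "S \<subseteq> U" and T: "T \<subseteq> U"
  shows "block_sum W S T - block_sum W S U * block_sum W T U
        \<le> \<epsilon> * sqrt (block_sum W S U * block_sum W (U - S) U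
             * block_sum W T U * block_sum W (U - T) U)"
proof -
  let ?J = "block_sum W"
  have comm: "?J S T = ?J T S" for S T by (rule block_sum_commute) (rule sym)
  have compl: "?J (U - S) T = ?J U T - ?J S T" if "S \<subseteq> U" for S T
  proof -
    have "S \<union> (U - S) = U" using that by blast
    then show ?thesis
      using block_sum_Un_left[of S "U - S" W T] finite_subset[OF that] U by simp
  qed
  have compl_U: "?J (U - S) U = 1 - ?J S U" if "S \<subseteq> U" for S
    using compl[OF that] total by simp
  have nn: "0 \<le> ?J S T" if "S \<subseteq> U" "T \<subseteq> U" for S T
    unfolding block_sum_def using that nonneg by (intro sum_nonneg) auto
  have mono: "?J S T \<le> ?J S' T'" if "S \<subseteq> S'" "S' \<subseteq> U" "T \<subseteq> T'" "T' \<subseteq> U" for S T S' T'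
    using that U by (intro block_sum_mono nonneg) (auto intro: finite_subset)
  have le1: "?J S U \<le> 1" if "S \<subseteq> U" for S using mono[of S U U U] that total by simp
  have \<epsilon>0: "0 \<le> \<epsilon>" using nn[of "U - {z}" U] small by simp
  have avoid: "?J S T - ?J S U * ?J T U
      \<le> \<epsilon> * sqrt (?J S U * (1 - ?J S U) * ?J T U * (1 - ?J T U))"
    if "S \<subseteq> U" "z \<notin> S" "T \<subseteq> U" "z \<notin> T" for S T
  proof (rule covariance_bound)
    show "?J S T \<le> ?J S U" using that by (intro mono) auto
    show "?J S T \<le> ?J T U" unfolding comm[of S T] using that by (intro mono) auto
    show "?J S T \<le> \<epsilon> * sqrt (?J S U * ?J T U)" using that by (intro part) auto
  qed (use that nn le1 \<epsilon> \<epsilon>0 in auto)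
  have mixed: "?J S U * ?J T U \<le> \<epsilon> * sqrt (?J S U * (1 - ?J S U) * ?J T U * (1 - ?J T U))"
    if "S \<subseteq> U" "z \<notin> S" "T \<subseteq> U" "z \<notin> T" for S T
  proof (rule product_le_of_small)
    show "?J S U \<le> \<epsilon> / 2" "?J T U \<le> \<epsilon> / 2"
      using that mono[of S "U - {z}" U U] mono[of T "U - {z}" U U] small by force+
  qed (use that nn \<epsilon> in auto)
  have refl: "?J (U - S) U = 1 - ?J S U" "?J (U - T) U = 1 - ?J T U"
    using S T by (simp_all add: compl_U)
  have cS: "?J (U - S) T = ?J T U - ?J S T" using compl[OF S, of T] comm[of U T] by simp
  have cT: "?J S (U - T) = ?J S U - ?J S T"
    using compl[OF T, of S] comm[of T S] comm[of U S] comm[of S "U - T"] by simp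
  have cST: "?J (U - S) (U - T) = 1 - ?J S U - ?J T U + ?J S T"
    using compl[OF S, of "U - T"] comm[of U "U - T"] cT refl by simp
  \<comment> \<open>Complementing both sets preserves the covariance and the right-hand side, which
    reduces the second case to the first. In the last two cases the covariance is at most the
    product of the masses of the set avoiding \<open>z\<close> and of the complement of the
    other.\<close>
  consider "z \<notin> S" "z \<notin> T" | "z \<in> S" "z \<in> T" | "z \<notin> S" "z \<in> T" | "z \<in> S" "z \<notin> T"
    by blast
  then show ?thesis
  proof cases
    case 1
    then show ?thesis using avoid[of S T] S T by (simp add: refl)
  next
    case 2
    then show ?thesis using avoid[of "U - S" "U - T"] S T
      by (simp add: refl cST algebra_simps)
  next
    case 3
    then have "?J S U * (1 - ?J T U) \<le> \<epsilon> * sqrt (?J S U * ?J (U - S) U * ?J T U * ?J (U - T) U)"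
      using mixed[of S "U - T"] S by (simp add: refl mult_ac)
    moreover have "?J S T \<le> ?J S U" using S T by (intro mono) auto
    ultimately show ?thesis by (simp add: algebra_simps)
  next
    case 4
    then have "(1 - ?J S U) * ?J T U \<le> \<epsilon> * sqrt (?J S U * ?J (U - S) U * ?J T U * ?J (U - T) U)"
      using mixed[of "U - S" T] T by (simp add: refl mult_ac)
    moreover have "?J S T \<le> ?J T U" unfolding comm[of S T] using S T by (intro mono) auto
    ultimately show ?thesis by (simp add: algebra_simps)
  qed
qed

section \<open>Choice of parameters for \<epsilon> strictly between 0 and 1\<close>

text \<open>With \<open>l = - ln \<epsilon>\<close> and \<open>p = exp (- l / K)\<close>, the
  interior part \<open>(2 * K - 1) * (1 - p)\<close> tends to \<open>2 * l\<close> and the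
  denominator to 2, so the quotient tends to \<open>(2 * l + 2) / 2\<close>.\<close>

lemma band_mass_tendsto:
  assumes "0 < \<epsilon>" "\<epsilon> < 1"
  shows "(\<lambda>K. \<epsilon> * ((2 * real K - 1) * (1 - \<epsilon> powr (1 / real K)) + 2) / (1 + \<epsilon> powr (1 / real K)))
    \<longlonglongrightarrow> Lambda \<epsilon>"
proof -
  define l where "l = - ln \<epsilon>"
  have l: "l > 0" "\<epsilon> = exp (- l)" using assms by (auto simp: l_def)
  have "(\<lambda>K. ((2 * real K - 1) * (1 - exp (- l / real K)) + 2) / (1 + exp (- l / real K)))
      \<longlonglongrightarrow> 1 + l"
    using l(1) by real_asymp
  from tendsto_mult_left[OF this, of \<epsilon>] show ?thesis
    using assms l by (simp add: Lambda_def powr_def)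
qed

text \<open>The parameters are fixed in order: \<open>K\<close> so that the band mass
  \<open>C\<close> exceeds \<open>L\<close>, then \<open>N\<close> so that the truncation loss is
  harmless, then the scale \<open>\<delta>\<close> in terms of \<open>N\<close>.\<close>

lemma exists_space_between_0_1:
  fixes \<epsilon> L :: real
  assumes \<epsilon>: "0 < \<epsilon>" "\<epsilon> < 1" and L: "0 \<le> L" "L < Lambda \<epsilon>"
  shows "\<exists>(M :: (real \<times> real) measure) F G.
           prob_space M \<and> subalgebra M F \<and> subalgebra M G \<and>
           (\<forall>A\<in>sets F. \<forall>B\<in>sets G.
              measure M (A \<inter> B) - measure M A * measure M B
                \<le> \<epsilon> * sqrt (measure M A * measure M (space M - A)
                             * measure M B * measure M (space M - B))) \<and>
           max_corr M F G \<ge> L"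
proof -
  have "\<forall>\<^sub>F K in sequentially. K \<ge> 1 \<and>
      L < \<epsilon> * ((2 * real K - 1) * (1 - \<epsilon> powr (1 / real K)) + 2) / (1 + \<epsilon> powr (1 / real K))"
    by (intro eventually_conj eventually_ge_at_top order_tendstoD(1)[OF band_mass_tendsto[OF \<epsilon>] L(2)])
  then obtain K where K: "K \<ge> 1" and
    LK: "L < \<epsilon> * ((2 * real K - 1) * (1 - \<epsilon> powr (1 / real K)) + 2) / (1 + \<epsilon> powr (1 / real K))"
    by (auto simp: eventually_sequentially)
  define p where "p = \<epsilon> powr (1 / real K)"
  have p: "0 < p" "p < 1"
    using \<epsilon> K powr_less_mono2[of "1 / real K" \<epsilon> 1] by (auto simp: p_def)
  have pK: "p ^ K = \<epsilon>"
    using \<epsilon> K p by (simp add: p_def powr_powr flip: powr_realpow)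
  define C where "C = (\<Sum>k\<in>{- int K..int K}. band p K k)"
  have C: "L < C"
    using LK by (simp add: C_def band_mass[OF p K] pK flip: p_def)
  \<comment> \<open>The spare 1, once scaled by \<open>\<delta>\<close>, pays for the squared mean
    \<open>e\<^sup>2\<close>.\<close>
  have "\<forall>\<^sub>F N in sequentially. L * real N \<le> (real N - 2 * real K) * C - 1"
    using C by real_asymp
  then have "\<forall>\<^sub>F N in sequentially. N \<ge> 2 * K \<and> L * real N \<le> (real N - 2 * real K) * C - 1"
    by (intro eventually_conj eventually_ge_at_top)
  then obtain N where N: "N \<ge> 2 * K" and LN: "L * real N \<le> (real N - 2 * real K) * C - 1"
    by (auto simp: eventually_sequentially)
  define D where "D = {1..int N}"
  define U where "U = insert 0 D"
  have D: "finite D" "0 \<notin> D" "card D = N" by (auto simp: D_def)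
  \<comment> \<open>Small enough for two ends: the kept atoms have mass at most
    \<open>\<delta> * N \<le> \<epsilon> / 2\<close>, and \<open>(\<delta> * N)\<^sup>2\<close>,
    which bounds the squared mean, is at most \<open>\<delta>\<close>.\<close>
  define \<delta> where "\<delta> = \<epsilon> / (2 * (real N)\<^sup>2)"
  have N2: "real N \<ge> 2" using N K by simp
  have \<delta>: "\<delta> > 0" "\<delta> * (real N)\<^sup>2 = \<epsilon> / 2" using \<epsilon> N2 by (auto simp: \<delta>_def)
  have "\<delta> * real N \<le> \<delta> * (real N)\<^sup>2"
    using \<delta> N2 by (intro mult_left_mono) (auto simp: power2_eq_square)
  then have \<delta>N: "\<delta> * real N \<le> \<epsilon> / 2" using \<delta> by simp
  define V where "V i j = band p K (j - i) * p powi (i + j)" for i j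
  define m where "m i = p powi (2 * i)" for i
  \<comment> \<open>Truncation leaves row \<open>i\<close> short of \<open>m i\<close>. The deficit
    goes to the cell shared with the large atom \<open>0\<close>, so the marginal of
    \<open>i\<close> is exactly \<open>\<delta> * m i\<close>; \<open>w\<close> then completes the
    total to 1.\<close>
  define r where "r i = \<delta> * (m i - (\<Sum>j\<in>D. V i j))" for i
  define w where "w = 1 - \<delta> * (\<Sum>i\<in>D. m i) - (\<Sum>i\<in>D. r i)"
  define W where "W i j = (if i \<in> D then if j \<in> D then \<delta> * V i j else r i
      else if j \<in> D then r j else w)" for i j
  have V_sym: "V i j = V j i" for i j
    unfolding V_def by (rule kernel_commute[OF p K])
  have W_sym: "W i j = W j i" for i j
    using V_sym[of i j] by (auto simp: W_def)
  have V_nonneg: "0 \<le> V i j" for i j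
    using p band_nonneg[OF p K] by (simp add: V_def)
  have m_le1: "m i \<le> 1" and pow_le1: "p powi i \<le> 1" if "i \<in> D" for i
    using that p by (auto simp: m_def D_def power_int_def power_le_one)
  have m_pos: "0 < m i" for i using p by (simp add: m_def)
  have r_nonneg: "0 \<le> r i" for i
    using kernel_row_sum_le[OF p K D(1), of i] \<delta> by (simp add: r_def m_def V_def)
  have mass: "\<delta> * (\<Sum>i\<in>D. m i) \<le> \<epsilon> / 2"
  proof -
    have "\<delta> * (\<Sum>i\<in>D. m i) \<le> \<delta> * real N"
      using \<delta> sum_mono[of D m "\<lambda>_. 1"] m_le1 D by simp
    then show ?thesis using \<delta>N by simp
  qed
  have "(\<Sum>i\<in>D. r i) \<le> \<delta> * (\<Sum>i\<in>D. m i)"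
    unfolding sum_distrib_left r_def using \<delta> V_nonneg
    by (intro sum_mono mult_left_mono) (auto intro!: sum_nonneg)
  then have w_nonneg: "0 \<le> w" using mass \<epsilon> by (simp add: w_def)
  have row: "(\<Sum>j\<in>U. W i j) = \<delta> * m i" if "i \<in> D" for i
    using that D by (simp add: U_def W_def r_def sum_distrib_left algebra_simps cong: sum.cong)
  have row0: "(\<Sum>j\<in>U. W 0 j) = 1 - \<delta> * (\<Sum>i\<in>D. m i)"
    using D by (simp add: U_def W_def w_def cong: sum.cong)
  have marginal: "block_sum W S U = \<delta> * (\<Sum>i\<in>S. m i)" if "S \<subseteq> D" for S
    unfolding block_sum_def sum_distrib_left using that by (intro sum.cong row) auto
  have block: "block_sum W S T = \<delta> * block_sum V S T" if "S \<subseteq> D" "T \<subseteq> D" for S T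
    unfolding block_sum_def sum_distrib_left using that by (intro sum.cong) (auto simp: W_def)
  have total: "block_sum W U U = 1"
    using D row0 marginal[of D] by (simp add: U_def block_sum_def)
  have UD: "U - {0} = D" using D by (auto simp: U_def)
  have part: "block_sum W S T \<le> \<epsilon> * sqrt (block_sum W S U * block_sum W T U)"
    if S: "S \<subseteq> D" and T: "T \<subseteq> D" for S T
  proof -
    have "block_sum W S T \<le> \<delta> * (\<epsilon> * sqrt ((\<Sum>i\<in>S. m i) * (\<Sum>i\<in>T. m i)))"
      using block_sum_kernel_le_sqrt[OF p K finite_subset[OF S D(1)] finite_subset[OF T D(1)]] \<delta>
      unfolding block[OF S T] V_def m_def pK by (intro mult_left_mono) auto
    also have "\<dots> = \<epsilon> * sqrt (block_sum W S U * block_sum W T U)"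
      unfolding marginal[OF S] marginal[OF T] using \<delta>
      by (simp add: real_sqrt_mult mult_ac)
    finally show ?thesis .
  qed
  \<comment> \<open>This is \<open>x powr (- 1 / 2)\<close> at \<open>x = p powi (2 * i)\<close>, so
    each kept atom contributes \<open>\<delta>\<close> to the second moment. The value 0 keeps the
    large atom out of all moments.\<close>
  define \<phi> where "\<phi> i = (if i \<in> D then p powi (- i) else 0)" for i
  have weighted: "(\<Sum>i\<in>U. \<Sum>j\<in>U. W i j * \<psi> i) = (\<Sum>i\<in>D. \<delta> * m i * \<psi> i)" if "\<psi> 0 = 0" for \<psi>
    unfolding sum_distrib_right[symmetric] using that D row by (simp add: U_def cong: sum.cong)
  define e where "e = (\<Sum>i\<in>U. \<Sum>j\<in>U. W i j * \<phi> i)"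
  have "e = (\<Sum>i\<in>D. \<delta> * m i * \<phi> i)"
    unfolding e_def using D by (intro weighted) (simp add: \<phi>_def)
  also have "\<dots> = (\<Sum>i\<in>D. \<delta> * p powi i)"
  proof (rule sum.cong)
    fix i assume "i \<in> D"
    have "m i * p powi (- i) = p powi i" using p by (simp add: m_def flip: power_int_add)
    then show "\<delta> * m i * \<phi> i = \<delta> * p powi i" using \<open>i \<in> D\<close> by (simp add: \<phi>_def)
  qed simp
  finally have e: "e = (\<Sum>i\<in>D. \<delta> * p powi i)" .
  have "0 \<le> e" unfolding e using \<delta> p by (intro sum_nonneg) auto
  moreover have "e \<le> (\<Sum>i\<in>D. \<delta> * 1)"
    unfolding e using \<delta> pow_le1 by (intro sum_mono mult_left_mono) auto
  ultimately have "e\<^sup>2 \<le> (\<delta> * real N)\<^sup>2" using D by (intro power_mono) (auto simp: mult.commute)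
  also have "\<dots> = \<delta> * (\<epsilon> / 2)" unfolding \<delta>(2)[symmetric] by (simp add: power2_eq_square)
  also have "\<dots> \<le> \<delta>" using \<delta> \<epsilon> by simp
  finally have e2: "e\<^sup>2 \<le> \<delta>" .
  have second: "(\<Sum>i\<in>U. \<Sum>j\<in>U. W i j * (\<phi> i)\<^sup>2) = \<delta> * real N"
  proof -
    have "(\<Sum>i\<in>U. \<Sum>j\<in>U. W i j * (\<phi> i)\<^sup>2) = (\<Sum>i\<in>D. \<delta> * m i * (\<phi> i)\<^sup>2)"
      using D by (intro weighted) (simp add: \<phi>_def)
    also have "\<dots> = (\<Sum>i\<in>D. \<delta>)"
    proof (rule sum.cong)
      fix i assume "i \<in> D"
      have "m i * (p powi (- i))\<^sup>2 = 1"
        using p by (simp add: m_def power2_eq_square flip: power_int_add)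
      then show "\<delta> * m i * (\<phi> i)\<^sup>2 = \<delta>" using \<open>i \<in> D\<close> by (simp add: \<phi>_def)
    qed simp
    finally show ?thesis using D by simp
  qed
  have mixed: "(\<Sum>i\<in>U. \<Sum>j\<in>U. W i j * (\<phi> i * \<phi> j)) = \<delta> * (\<Sum>i\<in>D. \<Sum>j\<in>D. band p K (j - i))"
  proof -
    have "(\<Sum>i\<in>U. \<Sum>j\<in>U. W i j * (\<phi> i * \<phi> j)) = (\<Sum>i\<in>D. \<Sum>j\<in>D. W i j * (\<phi> i * \<phi> j))"
      using D by (simp add: U_def \<phi>_def)
    also have "\<dots> = (\<Sum>i\<in>D. \<Sum>j\<in>D. \<delta> * band p K (j - i))"
    proof (intro sum.cong refl)
      fix i j assume "i \<in> D" "j \<in> D"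
      have "p powi (i + j) * (p powi (- i) * p powi (- j)) = 1"
        using p by (simp flip: power_int_add)
      then show "W i j * (\<phi> i * \<phi> j) = \<delta> * band p K (j - i)"
        using \<open>i \<in> D\<close> \<open>j \<in> D\<close> by (simp add: W_def \<phi>_def V_def)
    qed
    finally show ?thesis by (simp add: sum_distrib_left)
  qed
  show ?thesis
  proof (rule exists_space_of_finite_joint_law[where W = W and U = U and \<phi> = \<phi> and a = 1 and e = e])
    show "finite U" using D by (simp add: U_def)
    show nonneg: "0 \<le> W i j" for i j
      using \<delta> V_nonneg r_nonneg w_nonneg by (simp add: W_def)
    show "W i j = W j i" for i j by (rule W_sym)
    show "block_sum W U U = 1" by (rule total)
    show "block_sum W S T - block_sum W S U * block_sum W T U
        \<le> \<epsilon> * sqrt (block_sum W S U * block_sum W (U - S) U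
             * block_sum W T U * block_sum W (U - T) U)" if "S \<subseteq> U" "T \<subseteq> U" for S T
    proof (rule mixing_from_small_part[where z = 0])
      show "block_sum W (U - {0}) U \<le> \<epsilon> / 2"
        using mass marginal[of D] by (simp add: UD)
      show "block_sum W S T \<le> \<epsilon> * sqrt (block_sum W S U * block_sum W T U)"
        if "S \<subseteq> U - {0}" "T \<subseteq> U - {0}" for S T
        using that part unfolding UD by blast
    qed (use D \<epsilon> nonneg W_sym total that in \<open>auto simp: U_def\<close>)
    have 1: "1 \<in> D" using N K by (simp add: D_def)
    then show "1 \<in> U" by (simp add: U_def)
    have "block_sum W {1} U = \<delta> * m 1" using marginal[of "{1}"] 1 by simp
    moreover have "\<delta> * m 1 \<le> \<delta> * real N"
      using \<delta> m_le1[OF 1] N2 by (intro mult_left_mono) auto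
    ultimately show "0 < block_sum W {1} U" "block_sum W {1} U < 1"
      using mult_pos_pos[OF \<delta>(1) m_pos[of 1]] \<delta>N \<epsilon> by linarith+
    show "e = (\<Sum>i\<in>U. \<Sum>j\<in>U. W i j * \<phi> i)" by (rule e_def)
    show "\<delta> * real N - e\<^sup>2 = (\<Sum>i\<in>U. \<Sum>j\<in>U. W i j * (\<phi> i)\<^sup>2) - e\<^sup>2"
      unfolding second by simp
    have "\<delta> * 2 \<le> \<delta> * real N" using \<delta> N2 by (intro mult_left_mono) auto
    then show "0 < \<delta> * real N - e\<^sup>2" using e2 \<delta> by linarith
    have "L * (\<delta> * real N - e\<^sup>2) \<le> \<delta> * (L * real N)"
      using L by (simp add: algebra_simps)
    also have "\<dots> \<le> \<delta> * ((\<Sum>i\<in>D. \<Sum>j\<in>D. band p K (j - i)) - 1)"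
      using \<delta> LN band_square_sum_ge[OF p K, of N] N
      by (intro mult_left_mono) (auto simp: C_def D_def)
    also have "\<dots> \<le> (\<Sum>i\<in>U. \<Sum>j\<in>U. W i j * (\<phi> i * \<phi> j)) - e\<^sup>2"
      using e2 unfolding mixed by (simp add: algebra_simps)
    finally show "L * (\<delta> * real N - e\<^sup>2) \<le> (\<Sum>i\<in>U. \<Sum>j\<in>U. W i j * (\<phi> i * \<phi> j)) - e\<^sup>2" .
  qed
qed

section \<open>The endpoint cases and the full range of \<epsilon>\<close>

lemma subset_doubleton_cases:
  assumes "S \<subseteq> {x, y}"
  obtains "S = {}" | "S = {x}" | "S = {y}" | "S = {x, y}"
  using assms by blast

theorem theorem2p2p21:
  fixes \<epsilon> \<Lambda>' :: real
  assumes "0 \<le> \<epsilon>" and "\<epsilon> \<le> 1"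
    and "\<Lambda>' < Lambda \<epsilon>"
  shows "\<exists>(M :: (real \<times> real) measure) F G.
           prob_space M \<and> subalgebra M F \<and> subalgebra M G \<and>
           (\<forall>A\<in>sets F. \<forall>B\<in>sets G.
              measure M (A \<inter> B) - measure M A * measure M B
                \<le> \<epsilon> * sqrt (measure M A * measure M (space M - A)
                             * measure M B * measure M (space M - B))) \<and>
           max_corr M F G \<ge> \<Lambda>'"
proof -
  consider "\<epsilon> = 0" | "0 < \<epsilon>" "\<epsilon> < 1" | "\<epsilon> = 1" using assms by linarith
  then show ?thesis
  proof cases
    case 1
    then have "\<Lambda>' < 0" using assms by (simp add: Lambda_def)
    \<comment> \<open>Two independent fair bits, with correlation 0; \<open>1 / 2\<close> and
      \<open>1 / 4\<close> are the mean and variance of a fair bit.\<close>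
    then show ?thesis unfolding 1
      by (intro exists_space_of_finite_joint_law[where U = "{0, 1}" and W = "\<lambda>i j. 1 / 4"
          and \<phi> = of_int and a = 0 and e = "1 / 2" and v = "1 / 4"])
        (auto simp: block_sum_def power2_eq_square elim!: subset_doubleton_cases)
  next
    case 2
    have "0 < 1 + \<bar>ln \<epsilon>\<bar>" by linarith
    then have "0 < Lambda \<epsilon>" using mult_pos_pos[OF 2(1)] 2 unfolding Lambda_def by presburger
    \<comment> \<open>The lemma for this range takes a nonnegative target, hence the maximum with 0,
      which stays below the positive \<open>Lambda \<epsilon>\<close>.\<close>
    then show ?thesis
      using exists_space_between_0_1[OF 2, of "max 0 \<Lambda>'"] assms(3) by fastforce
  next
    case 3
    then have "\<Lambda>' < 1" using assms by (simp add: Lambda_def)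
    \<comment> \<open>Two equal fair bits have correlation 1; for singletons the four marginals
      under the root are all \<open>1 / 2\<close>.\<close>
    moreover have "sqrt (1 / 16) = (1 / 4 :: real)"
      by (rule real_sqrt_unique) (simp_all add: power2_eq_square)
    ultimately show ?thesis unfolding 3
      by (intro exists_space_of_finite_joint_law[where U = "{0, 1}" and W = "\<lambda>i j. if i = j then 1 / 2 else 0"
          and \<phi> = of_int and a = 0 and e = "1 / 2" and v = "1 / 4"])
        (auto simp: block_sum_def power2_eq_square elim!: subset_doubleton_cases)
  qed
qed

end
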